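(* Let $p$ be an odd prime with $p \equiv 1 \pmod 4$, let $k \geq 1$ be an integer, and let $t \in \mathbb{Z}_{p^k}$. If $t \neq 0$, write $t = p^{\alpha}\beta$ where $p \nmid \beta$ and $0 \le \alpha < k$. Then $$ N_{2}(t, p^k) = \begin{cases} p^{k-1} \left( p(k+1) - k \right) & \text{if } t = 0, \\ (\alpha + 1)(p - 1)p^{k-1} & \text{if } t \neq 0. \end{cases} $$
   Context: $\mathbb{Z}_n$ denotes the ring of integers modulo $n$. For $t \in \mathbb{Z}_n$, $N_2(t,n)$ is the number of ordered pairs $(x_1,x_2) \in \mathbb{Z}_n^2$ with $x_1^2+x_2^2 \equiv t \pmod n$ (zero entries are allowed). In the factorization $t = p^{\alpha}\beta$ the element $t$ is represented by a nonzero integer in $\{1,\dots,p^k-1\}$. *)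

theory Defs
  imports "HOL-Number_Theory.Number_Theory"
begin

text \<open>
  The elements of the ring of integers modulo \<open>n\<close> are the canonical representatives
  \<open>0, \<dots>, n - 1\<close>, i.e. the carrier of \<^const>\<open>residue_ring\<close>.
\<close>

definition N2 :: "int \<Rightarrow> int \<Rightarrow> nat" where
  "N2 t n = card {(x1, x2). x1 \<in> carrier (residue_ring n) \<and> x2 \<in> carrier (residue_ring n) \<and>
     [x1\<^sup>2 + x2\<^sup>2 = t] (mod n)}"

end

theory Submission
  imports Defs
begin

text \<open>
  Since \<open>p \<equiv> 1 (mod 4)\<close>, the number \<open>-1\<close> is a square modulo \<open>p\<close>, and by Hensel lifting there is
  an \<open>i\<close> with \<open>i\<^sup>2 \<equiv> -1 (mod p\<^sup>k)\<close>. Hence \<open>x\<^sup>2 + y\<^sup>2\<close> splits as \<open>(x + i y) (x - i y)\<close>, and because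
  \<open>2 i\<close> is a unit, \<open>(x, y) \<mapsto> (x + i y, x - i y)\<close> permutes the pairs of residues. So representations
  of \<open>t\<close> as a sum of two squares are as many as pairs with \<open>u v \<equiv> t\<close>
  (\<open>card_two_squares_eq_card_product\<close>).

  For such pairs, fix \<open>u\<close>: the linear congruence \<open>u v \<equiv> t (mod n)\<close> has \<open>gcd u n\<close> solutions \<open>v\<close> if
  \<open>gcd u n\<close> divides \<open>t\<close>, and none otherwise. As \<open>\<phi> (n / d)\<close> of the residues \<open>u\<close> have \<open>gcd u n = d\<close>,
  the count is \<open>\<Sum> d \<phi> (n / d)\<close> over the common divisors \<open>d\<close> of \<open>n\<close> and \<open>t\<close>
  (\<open>card_product_congruence\<close>). For \<open>n = p\<^sup>k\<close> the divisor \<open>d = p\<^sup>j\<close> contributes \<open>p\<^sup>k\<^sup>-\<^sup>1 (p - 1)\<close>,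
  independently of \<open>j\<close>, as long as \<open>j < k\<close>; this gives the factor \<open>\<alpha> + 1\<close>. For \<open>t = 0\<close>
  there are \<open>k\<close> such divisors together with \<open>d = p\<^sup>k\<close>, which contributes \<open>p\<^sup>k\<close>.
\<close>

section \<open>Pairs of residues with prescribed product\<close>

lemma card_residues_cong:
  fixes m w :: int and d :: nat
  assumes "m > 0"
  shows "card {v \<in> {0..<int d * m}. [v = w] (mod m)} = d"
proof -
  have "bij_betw (\<lambda>q. w mod m + m * int q) {..<d} {v \<in> {0..<int d * m}. [v = w] (mod m)}"
  proof (rule bij_betw_byWitness[where f' = "\<lambda>v. nat (v div m)"])
    show "\<forall>q\<in>{..<d}. nat ((w mod m + m * int q) div m) = q"
      using assms by simp
    show "\<forall>v\<in>{v \<in> {0..<int d * m}. [v = w] (mod m)}. w mod m + m * int (nat (v div m)) = v"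
      using assms by (auto simp: pos_imp_zdiv_nonneg_iff cong_def) (metis mod_mult_div_eq)
    show "(\<lambda>q. w mod m + m * int q) ` {..<d} \<subseteq> {v \<in> {0..<int d * m}. [v = w] (mod m)}"
    proof (clarsimp simp: cong_def, intro conjI)
      fix q assume "q < d"
      then have "m * (int q + 1) \<le> m * int d" using assms by simp
      moreover have "w mod m < m" using assms by simp
      ultimately show "w mod m + m * int q < int d * m" by (simp add: algebra_simps)
    qed (use assms in simp)
    show "(\<lambda>v. nat (v div m)) ` {v \<in> {0..<int d * m}. [v = w] (mod m)} \<subseteq> {..<d}"
    proof clarsimp
      fix v assume "0 \<le> v" "v < int d * m"
      have "v div m * m \<le> v"
        using assms by (simp flip: minus_mod_eq_div_mult)
      then have "v div m * m < int d * m" using \<open>v < int d * m\<close> by simp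
      then have "v div m < int d" using assms by simp
      moreover have "0 \<le> v div m" using assms \<open>0 \<le> v\<close> by (simp add: pos_imp_zdiv_nonneg_iff)
      ultimately show "nat (v div m) < d" by simp
    qed
  qed
  from bij_betw_same_card[OF this] show ?thesis by simp
qed

text \<open>
  Dividing \<open>u\<close>, \<open>t\<close> and \<open>n\<close> by \<open>gcd u n\<close> makes the coefficient a unit modulo \<open>n / gcd u n\<close>, so the
  solutions form one residue class to this smaller modulus.
\<close>
lemma card_linear_congruence:
  fixes u t n :: int
  assumes "n > 0"
  shows "card {v \<in> {0..<n}. [u * v = t] (mod n)} = (if gcd u n dvd t then nat (gcd u n) else 0)"
proof (cases "gcd u n dvd t")
  case False
  have "\<not> [u * v = t] (mod n)" for v
  proof
    assume "[u * v = t] (mod n)"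
    then have "[u * v = t] (mod gcd u n)" by (rule cong_dvd_modulus) simp
    then have "gcd u n dvd u * v \<longleftrightarrow> gcd u n dvd t" by (rule cong_dvd_iff)
    with False show False by simp
  qed
  then show ?thesis using False by simp
next
  case True
  define d where "d = gcd u n"
  have d: "d > 0" using assms by (simp add: d_def)
  obtain u' n' where u': "u = d * u'" and n': "n = d * n'" and "coprime u' n'"
    using gcd_coprime_exists[of u n] d by (metis d_def less_irrefl mult.commute)
  obtain t' where t': "t = d * t'" using True unfolding d_def by (rule dvdE)
  have "n' > 0" using assms d n' by (simp add: zero_less_mult_iff)
  obtain w0 where w0: "[u' * w0 = 1] (mod n')"
    using cong_solve_coprime_int \<open>coprime u' n'\<close> by blast
  have "[u' * (w0 * t') = t'] (mod n')"
    using cong_scalar_right[OF w0, of t'] by (simp add: mult.assoc)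
  then have "[u' * v = t'] (mod n') \<longleftrightarrow> [u' * v = u' * (w0 * t')] (mod n')" for v
    by (metis cong_sym cong_trans)
  then have "[u' * v = t'] (mod n') \<longleftrightarrow> [v = w0 * t'] (mod n')" for v
    using cong_mult_lcancel[OF \<open>coprime u' n'\<close>] by metis
  moreover have "[u * v = t] (mod n) \<longleftrightarrow> [u' * v = t'] (mod n')" for v
    using d by (simp add: u' n' t' cong_iff_dvd_diff mult.assoc flip: right_diff_distrib)
  ultimately have "card {v \<in> {0..<n}. [u * v = t] (mod n)} =
      card {v \<in> {0..<int (nat d) * n'}. [v = w0 * t'] (mod n')}"
    using d by (simp add: n')
  also have "\<dots> = nat d" using \<open>n' > 0\<close> by (rule card_residues_cong)
  finally show ?thesis using True by (simp add: d_def)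
qed

text \<open>
  Sum the number of solutions \<open>v\<close> over all \<open>u\<close>, and group the \<open>u\<close> by their gcd with \<open>n\<close>.
\<close>
lemma card_product_congruence:
  fixes n :: nat and t :: int
  assumes "n > 0"
  shows "card {(u, v). u \<in> {0..<int n} \<and> v \<in> {0..<int n} \<and> [u * v = t] (mod int n)} =
    (\<Sum>d | d dvd n \<and> int d dvd t. d * totient (n div d))"
proof -
  define h where "h = (\<lambda>d::nat. if int d dvd t then d else 0)"
  have "{(u, v). u \<in> {0..<int n} \<and> v \<in> {0..<int n} \<and> [u * v = t] (mod int n)} =
      (SIGMA u:{0..<int n}. {v \<in> {0..<int n}. [u * v = t] (mod int n)})"
    by auto
  then have "card {(u, v). u \<in> {0..<int n} \<and> v \<in> {0..<int n} \<and> [u * v = t] (mod int n)} =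
      (\<Sum>u\<in>{0..<int n}. card {v \<in> {0..<int n}. [u * v = t] (mod int n)})"
    by (simp del: atLeastLessThan_iff)
  also have "\<dots> = (\<Sum>u\<in>{0..<int n}. h (nat (gcd u (int n))))"
    using assms by (intro sum.cong) (simp_all add: card_linear_congruence h_def del: atLeastLessThan_iff)
  \<comment> \<open>The totient counts in the range from \<open>1\<close> to \<open>n\<close>, so \<open>n\<close> replaces \<open>0\<close> as a representative.\<close>
  also have "\<dots> = (\<Sum>k\<in>{0<..n}. h (gcd k n))"
  proof (rule sum.reindex_bij_witness[where i = "\<lambda>k. int k mod int n"
        and j = "\<lambda>u. if u = 0 then n else nat u"])
    show "h (gcd (if u = 0 then n else nat u) n) = h (nat (gcd u (int n)))"
      if "u \<in> {0..<int n}" for u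
      using that by (auto simp: gcd_int_def)
    show "int (if u = 0 then n else nat u) mod int n = u" if "u \<in> {0..<int n}" for u
      using that by auto
    show "(if u = 0 then n else nat u) \<in> {0<..n}" if "u \<in> {0..<int n}" for u
      using that assms by auto
    show "int k mod int n \<in> {0..<int n}" if "k \<in> {0<..n}" for k
      using assms by auto
    show "(if int k mod int n = 0 then n else nat (int k mod int n)) = k" if "k \<in> {0<..n}" for k
      using that by (cases "k = n") auto
  qed
  also have "\<dots> = (\<Sum>d | d dvd n. \<Sum>k | k \<in> {0<..n} \<and> gcd k n = d. h (gcd k n))"
    by (rule sum.group[symmetric]) (use assms in auto)
  also have "\<dots> = (\<Sum>d | d dvd n. h d * totient (n div d))"
  proof (rule sum.cong[OF refl])
    fix d assume "d \<in> {d. d dvd n}"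
    then have "card {k \<in> {0<..n}. gcd k n = d} = totient (n div d)"
      using assms by (intro card_gcd_eq_totient) auto
    moreover have "(\<Sum>k | k \<in> {0<..n} \<and> gcd k n = d. h (gcd k n)) =
        (\<Sum>k | k \<in> {0<..n} \<and> gcd k n = d. h d)"
      by (rule sum.cong) auto
    ultimately show "(\<Sum>k | k \<in> {0<..n} \<and> gcd k n = d. h (gcd k n)) = h d * totient (n div d)"
      by (simp only: sum_constant mult.commute of_nat_id)
  qed
  also have "\<dots> = (\<Sum>d | d dvd n \<and> int d dvd t. d * totient (n div d))"
    by (rule sum.mono_neutral_cong_right) (use assms in \<open>auto simp: h_def\<close>)
  finally show ?thesis .
qed

section \<open>Factoring a sum of two squares\<close>

text \<open>
  The substitution \<open>(x, y) \<mapsto> (x + i y, x - i y)\<close> turns the sum of squares into a product. It has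
  determinant \<open>- 2 i\<close>, a unit, so it is injective, hence bijective on the finite set of pairs.
\<close>
lemma card_two_squares_eq_card_product:
  fixes n i t :: int
  assumes "odd n" and "[i\<^sup>2 = - 1] (mod n)"
  shows "card {(x, y). x \<in> {0..<n} \<and> y \<in> {0..<n} \<and> [x\<^sup>2 + y\<^sup>2 = t] (mod n)} =
    card {(u, v). u \<in> {0..<n} \<and> v \<in> {0..<n} \<and> [u * v = t] (mod n)}"
proof (cases "n > 0")
  case True
  define S where "S = {0..<n} \<times> {0..<n}"
  define f where "f = (\<lambda>(x, y). ((x + i * y) mod n, (x - i * y) mod n))"
  have "[i * (- i) = 1] (mod n)"
    using cong_uminus[OF assms(2)] by (simp add: power2_eq_square)
  then have cop_i: "coprime i n" 
    unfolding coprime_iff_invertible_int by blast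
  have cop_2: "coprime 2 n" using assms(1) by simp
  have "f ` S \<subseteq> S" using True by (auto simp: S_def f_def)
  moreover have "inj_on f S"
  proof (rule inj_onI, clarsimp simp: f_def S_def)
    fix x y x' y' :: int
    assume ranges: "0 \<le> x" "x < n" "0 \<le> y" "y < n" "0 \<le> x'" "x' < n" "0 \<le> y'" "y' < n"
      and "(x + i * y) mod n = (x' + i * y') mod n" "(x - i * y) mod n = (x' - i * y') mod n"
    then have plus: "[x + i * y = x' + i * y'] (mod n)" and minus: "[x - i * y = x' - i * y'] (mod n)"
      by (simp_all add: cong_def)
    have "[2 * x = 2 * x'] (mod n)" using cong_add[OF plus minus] by simp
    then have "[x = x'] (mod n)" by (simp add: cong_mult_lcancel[OF cop_2])
    moreover have "[2 * (i * y) = 2 * (i * y')] (mod n)" using cong_diff[OF plus minus] by simp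
    then have "[y = y'] (mod n)" by (simp add: cong_mult_lcancel[OF cop_2] cong_mult_lcancel[OF cop_i])
    ultimately show "x = x' \<and> y = y'" using ranges cong_less_imp_eq_int by blast
  qed
  ultimately have "bij_betw f S S"
    by (simp add: S_def bij_betw_def endo_inj_surj)
  moreover have "[fst (f z) * snd (f z) = (fst z)\<^sup>2 + (snd z)\<^sup>2] (mod n)" for z
  proof -
    obtain x y where z: "z = (x, y)" by (cases z)
    have "[fst (f z) * snd (f z) = (x + i * y) * (x - i * y)] (mod n)"
      by (simp add: f_def z cong_mult)
    also have "(x + i * y) * (x - i * y) = x\<^sup>2 - i\<^sup>2 * y\<^sup>2"
      by (simp add: power2_eq_square algebra_simps)
    also have "[x\<^sup>2 - i\<^sup>2 * y\<^sup>2 = x\<^sup>2 - (- 1) * y\<^sup>2] (mod n)"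
      by (intro cong_diff cong_mult cong_refl assms(2))
    finally show ?thesis by (simp add: z)
  qed
  then have "[fst (f z) * snd (f z) = t] (mod n) \<longleftrightarrow> [(fst z)\<^sup>2 + (snd z)\<^sup>2 = t] (mod n)" for z
    by (metis cong_sym cong_trans)
  ultimately have "bij_betw f {z \<in> S. [(fst z)\<^sup>2 + (snd z)\<^sup>2 = t] (mod n)} {z \<in> S. [fst z * snd z = t] (mod n)}"
    by (intro bij_betw_Collect) auto
  then have "card {z \<in> S. [(fst z)\<^sup>2 + (snd z)\<^sup>2 = t] (mod n)} = card {z \<in> S. [fst z * snd z = t] (mod n)}"
    by (rule bij_betw_same_card)
  moreover have "{z \<in> S. [(fst z)\<^sup>2 + (snd z)\<^sup>2 = t] (mod n)} =
      {(x, y). x \<in> {0..<n} \<and> y \<in> {0..<n} \<and> [x\<^sup>2 + y\<^sup>2 = t] (mod n)}"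
    and "{z \<in> S. [fst z * snd z = t] (mod n)} =
      {(u, v). u \<in> {0..<n} \<and> v \<in> {0..<n} \<and> [u * v = t] (mod n)}"
    by (auto simp: S_def)
  ultimately show ?thesis by (simp only:)
qed simp

section \<open>A square root of \<open>-1\<close> modulo a prime power\<close>

lemma QuadRes_minus_one:
  fixes p :: int
  assumes "prime p" and "[p = 1] (mod 4)"
  shows "QuadRes p (- 1)"
proof -
  have "p > 2"
    using prime_gt_1_int[OF assms(1)] assms(2) by (cases "p = 2") (auto simp: cong_def)
  define q where "q = nat p"
  have p: "p = int q" and q: "prime q" "q > 2"
    using assms(1) \<open>p > 2\<close> by (auto simp: q_def)
  have "[q = 1] (mod 4)"
    using assms(2) by (simp add: p flip: cong_int_iff)
  then have "even ((q - 1) div 2)"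
    using q(2) unfolding cong_def by presburger
  then have "[Legendre (- 1) (int q) = 1] (mod int q)"
    using euler_criterion[OF q, of "- 1"] by simp
  moreover have "\<not> [0 = 1] (mod int q)" "\<not> [- 1 = 1] (mod int q)"
    using q(2) zdvd_imp_le[of "int q" 2]  by (auto simp: cong_iff_dvd_diff)
  ultimately show ?thesis
    by (auto simp: Legendre_def p split: if_splits)
qed

text \<open>
  Hensel's lemma for \<open>y\<^sup>2 - a\<close>. If \<open>y\<^sup>2 = a + p\<^sup>k m\<close>, then replacing \<open>y\<close> by \<open>y + p\<^sup>k s\<close> changes the
  cofactor \<open>m\<close> to \<open>m + 2 y s\<close> modulo \<open>p\<close>, and this vanishes for a suitable \<open>s\<close> because \<open>2 y\<close> is a
  unit modulo \<open>p\<close>.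
\<close>
lemma QuadRes_power_lift:
  fixes p a :: int
  assumes "QuadRes p a" and "coprime (2 * a) p" and "k \<ge> 1"
  shows "QuadRes (p ^ k) a"
  using assms(3)
proof (induction k rule: dec_induct)
  case base
  then show ?case using assms(1) by simp
next
  case (step k)
  then obtain y where y: "[y\<^sup>2 = a] (mod p ^ k)" by (auto simp: QuadRes_def)
  then obtain m where m: "y\<^sup>2 = a + p ^ k * m" by (metis cong_iff_lin cong_sym)
  have "[y\<^sup>2 = a] (mod p)" using y \<open>1 \<le> k\<close> by (intro cong_dvd_modulus[OF y]) simp
  then have "coprime (2 * y) p"
    using assms(2) cong_imp_coprime[of a "y\<^sup>2" p] by (auto simp: cong_sym_eq)
  then obtain r where r: "[2 * y * r = 1] (mod p)" using cong_solve_coprime_int by blast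
  define s where "s = - (m * r)"
  have "[m + 2 * y * s = m - m * 1] (mod p)"
    using cong_diff[OF cong_refl[of m] cong_scalar_left[OF r, of m]]
    by (simp add: s_def algebra_simps)
  then have "p dvd m + 2 * y * s" by (simp add: cong_0_iff)
  then have "p ^ Suc k dvd p ^ k * (m + 2 * y * s)" by (simp add: mult.commute mult_dvd_mono)
  moreover have "p ^ Suc k dvd p ^ k * p ^ k"
    using \<open>1 \<le> k\<close> le_imp_power_dvd[of "Suc k" "k + k" p] by (simp add: power_add)
  then have "p ^ Suc k dvd p ^ k * p ^ k * s\<^sup>2" by (rule dvd_mult2)
  moreover have "(y + p ^ k * s)\<^sup>2 - a = p ^ k * (m + 2 * y * s) + p ^ k * p ^ k * s\<^sup>2"
    by (simp add: power2_sum m power_mult_distrib power2_eq_square[of "p ^ k"] algebra_simps)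
  ultimately have "p ^ Suc k dvd (y + p ^ k * s)\<^sup>2 - a" by (metis dvd_add)
  then show ?case unfolding QuadRes_def cong_iff_dvd_diff by blast
qed

section \<open>The count for a prime power\<close>

text \<open>
  Here \<open>a\<close> stands for the exponent of \<open>q\<close> in \<open>t\<close>. The hypothesis constrains it only up to \<open>k\<close>, so
  that \<open>t = 0\<close> is covered by \<open>a = k\<close>.
\<close>
lemma divisor_sum_prime_power:
  fixes q k a :: nat and t :: int
  assumes "prime q"
    and "\<And>j. j \<le> k \<Longrightarrow> int q ^ j dvd t \<longleftrightarrow> j \<le> a" 
  shows "(\<Sum>d | d dvd q ^ k \<and> int d dvd t. d * totient (q ^ k div d)) =
    (\<Sum>j\<in>{..min a k}. q ^ j * totient (q ^ (k - j)))"
proof (rule sum.reindex_cong[where l = "\<lambda>j. q ^ j"])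
  show "inj_on ((^) q) {..min a k}"
    using prime_gt_1_nat[OF assms(1)] by (auto intro!: inj_onI)
  show "{d. d dvd q ^ k \<and> int d dvd t} = (^) q ` {..min a k}"
    using assms(2) by (auto simp: divides_primepow_nat[OF assms(1)])
  show "q ^ j * totient (q ^ k div q ^ j) = q ^ j * totient (q ^ (k - j))" if "j \<in> {..min a k}" for j
    using that prime_gt_0_nat[OF assms(1)] by (simp add: power_diff)
qed

lemma prime_power_times_totient:
  fixes q j k :: nat
  assumes "prime q" and "j < k"
  shows "q ^ j * totient (q ^ (k - j)) = q ^ (k - 1) * (q - 1)"
proof -
  have "q ^ j * totient (q ^ (k - j)) = q ^ (j + (k - j - 1)) * (q - 1)"
    by (subst totient_prime_power) (use assms in \<open>simp_all only: power_add mult.assoc zero_less_diff\<close>)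
  also have "j + (k - j - 1) = k - 1" using assms(2) by simp
  finally show ?thesis .
qed

theorem theorem1p9:
  fixes p t \<beta> :: int and k \<alpha> :: nat
  assumes "prime p" and "odd p" and "[p = 1] (mod 4)"
    and "k \<ge> 1"
    and "t \<in> carrier (residue_ring (p ^ k))"
    and "t \<noteq> 0 \<Longrightarrow> t = p ^ \<alpha> * \<beta> \<and> \<not> p dvd \<beta> \<and> \<alpha> < k"
  shows "int (N2 t (p ^ k)) =
    (if t = 0 then p ^ (k - 1) * (p * (int k + 1) - int k)
     else (int \<alpha> + 1) * (p - 1) * p ^ (k - 1))"
proof -
  define q where "q = nat p"
  have p: "p = int q" and q: "prime q" and "q \<ge> 1"
    using assms(1) prime_gt_1_int[OF assms(1)] by (auto simp: q_def)
  have "coprime (2 * - 1) p" using assms(2) by simp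
  then obtain i where i: "[i\<^sup>2 = - 1] (mod p ^ k)"
    using QuadRes_power_lift[OF QuadRes_minus_one[OF assms(1,3)]] assms(4)
    by (auto simp: QuadRes_def)
  have "{0..p ^ k - 1} = {0..<p ^ k}" by auto
  then have "N2 t (p ^ k) =
      card {(x, y). x \<in> {0..<p ^ k} \<and> y \<in> {0..<p ^ k} \<and> [x\<^sup>2 + y\<^sup>2 = t] (mod p ^ k)}"
    by (simp add: N2_def residue_ring_def)
  also have "\<dots> = card {(u, v). u \<in> {0..<p ^ k} \<and> v \<in> {0..<p ^ k} \<and> [u * v = t] (mod p ^ k)}"
    using assms(2) i by (intro card_two_squares_eq_card_product) auto
  also have "\<dots> = (\<Sum>d | d dvd q ^ k \<and> int d dvd t. d * totient (q ^ k div d))"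
    using card_product_congruence[of "q ^ k" t] \<open>q \<ge> 1\<close> by (simp add: p)
  finally have N2: "N2 t (p ^ k) = (\<Sum>d | d dvd q ^ k \<and> int d dvd t. d * totient (q ^ k div d))" .
  show ?thesis
  proof (cases "t = 0")
    case True
    have "N2 t (p ^ k) = (\<Sum>j\<in>{..k}. q ^ j * totient (q ^ (k - j)))"
      using N2 divisor_sum_prime_power[OF q, of k t k] True by simp
    also have "\<dots> = (\<Sum>j<k. q ^ j * totient (q ^ (k - j))) + q ^ k"
      by (simp flip: lessThan_Suc_atMost)
    also have "\<dots> = k * (q ^ (k - 1) * (q - 1)) + q * q ^ (k - 1)"
      using assms(4) by (simp add: prime_power_times_totient[OF q] flip: power_Suc)
    finally have "int (N2 t (p ^ k)) = int k * (p ^ (k - 1) * (p - 1)) + p * p ^ (k - 1)"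
      using \<open>q \<ge> 1\<close> by (simp add: p of_nat_diff)
    then show ?thesis using True by (simp add: algebra_simps)
  next
    case False
    then have t: "t = p ^ \<alpha> * \<beta>" and "\<not> p dvd \<beta>" and "\<alpha> < k" using assms(6) by auto
    have "p ^ j dvd t \<longleftrightarrow> j \<le> \<alpha>" for j
    proof
      assume "p ^ j dvd t"
      show "j \<le> \<alpha>"
      proof (rule ccontr)
        assume "\<not> j \<le> \<alpha>"
        then have "p ^ Suc \<alpha> dvd t"
          using \<open>p ^ j dvd t\<close> by (meson dvd_trans le_imp_power_dvd not_less_eq_eq)
        then show False using \<open>\<not> p dvd \<beta>\<close> \<open>q \<ge> 1\<close> by (simp add: t p mult.commute)
      qed
    qed (simp add: t le_imp_power_dvd)
    then have "N2 t (p ^ k) = (\<Sum>j\<in>{..\<alpha>}. q ^ j * totient (q ^ (k - j)))"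
      using N2 divisor_sum_prime_power[OF q, of k t \<alpha>] \<open>\<alpha> < k\<close> by (simp add: p)
    also have "\<dots> = (\<alpha> + 1) * (q ^ (k - 1) * (q - 1))"
      using \<open>\<alpha> < k\<close> by (simp add: prime_power_times_totient[OF q])
    finally have "int (N2 t (p ^ k)) = (int \<alpha> + 1) * (p ^ (k - 1) * (p - 1))"
      using \<open>q \<ge> 1\<close> by (simp add: p of_nat_diff distrib_right)
    then show ?thesis using False by simp
  qed
qed
end
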